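(* Let $n\ge 1$ and let $\varrho=(\rho_1,\dots,\rho_n)$ be an $n$-tuple of single-qubit density matrices $\rho_k\in\mathcal{D}(\mathbb{C}^2)$, with Bloch vectors $\mathbf{r}_1,\dots,\mathbf{r}_n\in\mathbb{R}^3$ and Gram matrix $G_{\mathbf{r}_\varrho}=(\langle \mathbf{r}_k,\mathbf{r}_l\rangle)_{k,l=1}^n$. Then $\varrho$ has imaginarity, i.e. $\varrho\notin\mathcal{R}_n(\mathbb{C}^2)$, if and only if $\mathrm{rank}(G_{\mathbf{r}_\varrho})=3$.
   Context: $\mathcal{D}(\mathbb{C}^d)$ is the set of density matrices (positive semidefinite, trace one) on $\mathbb{C}^d$. A multi-state $\varrho:[n]\to\mathcal{D}(\mathbb{C}^d)$, $[n]=\{1,\dots,n\}$, is identified with the tuple $(\rho_1,\dots,\rho_n)$, $\rho_i=\varrho(i)$. It is imaginarity-free if there is an orthonormal basis $\{|a_i\rangle\}_{i=1}^d$ of $\mathbb{C}^d$ such that $\langle a_i|\rho_k|a_j\rangle\in\mathbb{R}$ for all $i,j$ and all $k$; otherwise it has imaginarity. $\mathcal{R}_n(\mathbb{C}^d)$ denotes the set of imaginarity-free $n$-tuples. The Bloch vector of $\rho\in\mathcal{D}(\mathbb{C}^2)$ is the unique $\mathbf{r}\in\mathbb{R}^3$, $\|\mathbf{r}\|\le 1$, with $\rho=\frac{1}{2}(\mathbb{1}+\mathbf{r}\cdot\boldsymbol{\sigma})$, where $\boldsymbol{\sigma}=(\sigma_x,\sigma_y,\sigma_z)$ are the Pauli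 matrices. *)

theory Defs
  imports "HOL-Analysis.Analysis"
begin

text \<open>
  The space \<open>\<complex>\<^sup>d\<close> is \<open>complex ^ 'd\<close>, operators on it are matrices \<open>complex ^ 'd ^ 'd\<close> (row index
  first), and an \<open>n\<close>-tuple is a function on an index type \<open>'n\<close> of class \<open>finite\<close>, \<open>n = CARD('n)\<close>.
  The library's inner product on \<open>complex ^ 'd\<close> is the real one, so the Hermitian
  product \<open>\<langle>v|w\<rangle>\<close> is defined here, antilinear in its first argument.
\<close>

definition cinner :: "complex ^ 'd \<Rightarrow> complex ^ 'd \<Rightarrow> complex" where
  "cinner v w = (\<Sum>i\<in>UNIV. cnj (v $ i) * w $ i)"

definition adjoint_mat :: "complex ^ 'd ^ 'd \<Rightarrow> complex ^ 'd ^ 'd" where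
  "adjoint_mat A = (\<chi> i j. cnj (A $ j $ i))"

definition positive_semidefinite :: "complex ^ 'd ^ 'd \<Rightarrow> bool" where
  "positive_semidefinite A \<longleftrightarrow>
     adjoint_mat A = A \<and> (\<forall>v. cinner v (A *v v) \<in> \<real>\<^sub>\<ge>\<^sub>0)"

definition density_matrices :: "(complex ^ 'd ^ 'd) set" where
  "density_matrices = {\<rho>. positive_semidefinite \<rho> \<and> trace \<rho> = 1}"

text \<open>\<open>vec.span\<close> is the span over the scalar field \<open>complex\<close> (plain \<open>span\<close> would be over \<open>real\<close>).\<close>

definition orthonormal_basis :: "('d \<Rightarrow> complex ^ 'd) \<Rightarrow> bool" where
  "orthonormal_basis a \<longleftrightarrow>
     (\<forall>i j. cinner (a i) (a j) = (if i = j then 1 else 0)) \<and> vec.span (range a) = UNIV"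

definition imaginarity_free :: "('n::finite \<Rightarrow> complex ^ 'd ^ 'd) set" where
  "imaginarity_free =
     {\<rho>. (\<forall>k. \<rho> k \<in> density_matrices) \<and>
          (\<exists>a. orthonormal_basis a \<and> (\<forall>k i j. cinner (a i) (\<rho> k *v a j) \<in> \<real>))}"

definition pauli_x :: "complex ^ 2 ^ 2" where
  "pauli_x = vector [vector [0, 1], vector [1, 0]]"

definition pauli_y :: "complex ^ 2 ^ 2" where
  "pauli_y = vector [vector [0, - \<i>], vector [\<i>, 0]]"

definition pauli_z :: "complex ^ 2 ^ 2" where
  "pauli_z = vector [vector [1, 0], vector [0, - 1]]"

definition is_bloch_vector :: "complex ^ 2 ^ 2 \<Rightarrow> real ^ 3 \<Rightarrow> bool" where
  "is_bloch_vector \<rho> r \<longleftrightarrow>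
     norm r \<le> 1 \<and>
     \<rho> = (1 / 2) *\<^sub>R (mat 1 + (r $ 1 *\<^sub>R pauli_x + r $ 2 *\<^sub>R pauli_y + r $ 3 *\<^sub>R pauli_z))"

definition bloch_vector :: "complex ^ 2 ^ 2 \<Rightarrow> real ^ 3" where
  "bloch_vector \<rho> = (THE r. is_bloch_vector \<rho> r)"

lemma is_bloch_vector_iff:
  "is_bloch_vector \<rho> r \<longleftrightarrow> norm r \<le> 1 \<and>
     \<rho> $ 1 $ 1 = Complex ((1 + r $ 3) / 2) 0 \<and> \<rho> $ 1 $ 2 = Complex (r $ 1 / 2) (- r $ 2 / 2) \<and>
     \<rho> $ 2 $ 1 = Complex (r $ 1 / 2) (r $ 2 / 2) \<and> \<rho> $ 2 $ 2 = Complex ((1 - r $ 3) / 2) 0"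
  unfolding is_bloch_vector_def
  by (auto simp: vec_eq_iff forall_2 pauli_x_def pauli_y_def pauli_z_def mat_def complex_eq_iff)

lemma bloch_vector_exists_unique:
  assumes "\<rho> \<in> density_matrices"
  shows "\<exists>!r. is_bloch_vector \<rho> r"
proof -
  define a where "a = Re (\<rho> $ 1 $ 1)"
  define d where "d = Re (\<rho> $ 2 $ 2)"
  define b where "b = \<rho> $ 2 $ 1"
  have adj: "adjoint_mat \<rho> = \<rho>" and pos: "\<And>v. cinner v (\<rho> *v v) \<in> \<real>\<^sub>\<ge>\<^sub>0" and tr: "trace \<rho> = 1"
    using assms by (auto simp: density_matrices_def positive_semidefinite_def)
  have h: "cnj (\<rho> $ j $ i) = \<rho> $ i $ j" for i j
    using arg_cong[OF adj, of "\<lambda>A. A $ i $ j"] by (simp add: adjoint_mat_def)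
  have e11: "\<rho> $ 1 $ 1 = Complex a 0" and e22: "\<rho> $ 2 $ 2 = Complex d 0"
    using h[of 1 1] h[of 2 2] by (auto simp: a_def d_def complex_eq_iff)
  have e12: "\<rho> $ 1 $ 2 = cnj b" using h[of 2 1] by (simp add: b_def)
  have ad: "a + d = 1" using tr by (simp add: trace_def sum_2 e11 e22 complex_eq_iff)
  have q: "0 \<le> Re (cnj x * (Complex a 0 * x + cnj b * y) + cnj y * (b * x + Complex d 0 * y))" for x y
  proof -
    have "cinner (vector [x, y]) (\<rho> *v vector [x, y]) =
        cnj x * (Complex a 0 * x + cnj b * y) + cnj y * (b * x + Complex d 0 * y)"
      by (simp add: cinner_def matrix_vector_mult_def sum_2 e11 e12 e22 flip: b_def)
    then show ?thesis
      using pos[of "vector [x, y]"] by (auto simp: complex_nonneg_Reals_iff)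
  qed
  have a0: "0 \<le> a" using q[of 1 0] by simp
  have d0: "0 \<le> d" using q[of 0 1] by simp
  have det: "(Re b)\<^sup>2 + (Im b)\<^sup>2 \<le> a * d"
  proof (cases "a = 0 \<and> d = 0")
    case True
    then show ?thesis using ad by simp
  next
    case False
    have "0 \<le> a * (a * d - ((Re b)\<^sup>2 + (Im b)\<^sup>2))"
      using q[of "- cnj b" "complex_of_real a"] by (simp add: algebra_simps power2_eq_square)
    moreover have "0 \<le> d * (a * d - ((Re b)\<^sup>2 + (Im b)\<^sup>2))"
      using q[of "complex_of_real d" "- b"] by (simp add: algebra_simps power2_eq_square)
    ultimately have "0 \<le> (a + d) * (a * d - ((Re b)\<^sup>2 + (Im b)\<^sup>2))"
      by (simp only: distrib_right)
    then show ?thesis by (simp add: ad)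
  qed
  define r :: "real ^ 3" where "r = vector [2 * Re b, 2 * Im b, a - d]"
  have "(norm r)\<^sup>2 = 4 * ((Re b)\<^sup>2 + (Im b)\<^sup>2) + (a - d)\<^sup>2"
    unfolding power2_norm_eq_inner by (simp add: inner_vec_def sum_3 r_def power2_eq_square)
  also have "\<dots> \<le> (a + d)\<^sup>2"
    using det by (simp add: power2_eq_square algebra_simps)
  finally have "norm r \<le> 1" by (simp add: ad abs_square_le_1)
  then have "is_bloch_vector \<rho> r"
    using ad by (simp add: is_bloch_vector_iff e11 e22 e12 r_def complex_eq_iff flip: b_def)
  moreover have "s = r" if "is_bloch_vector \<rho> s" for s
    using that \<open>is_bloch_vector \<rho> r\<close>
    by (auto simp: is_bloch_vector_iff vec_eq_iff forall_3)
  ultimately show ?thesis by blast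
qed

definition gram_matrix :: "('n::finite \<Rightarrow> real ^ 3) \<Rightarrow> real ^ 'n ^ 'n" where
  "gram_matrix r = (\<chi> k l. r k \<bullet> r l)"

end

(* For orthonormal v, w the form Im <v|rho w> equals m . r / 2, where r is the Bloch vector of rho
   and m is the vector of imaginary parts of c_i = <v|sigma_i|w>. The vector m never vanishes:
   since sum_i c_i^2 = <v|w>^2 = 0, real c_i would all be zero. Conversely, the Hopf map shows that
   every unit vector m arises up to sign. Hence a tuple is imaginarity-free iff its Bloch vectors
   lie in a common plane through the origin, i.e. iff their Gram matrix has rank below 3. *)

theory Submission
  imports Defs
begin

text \<open>With the vectors as rows of \<open>A\<close>, the Gram matrix is
  \<open>A ** transpose A\<close>. On the range \<open>W\<close> of \<open>transpose A\<close> the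
  map \<open>A\<close> is injective: if \<open>y = transpose A *v x\<close> and
  \<open>A *v y = 0\<close>, then \<open>y \<bullet> y = x \<bullet> (A *v y) = 0\<close>. So the
  rank is that of \<open>transpose A\<close>, hence the row rank of \<open>A\<close>.\<close>

lemma rank_gram_matrix:
  fixes r :: "'n::finite \<Rightarrow> real ^ 3"
  shows "rank (gram_matrix r) = dim (range r)"
proof -
  define A :: "real ^ 3 ^ 'n" where "A = (\<chi> k. r k)"
  define W where "W = range (\<lambda>x. transpose A *v x)"
  have G: "gram_matrix r = A ** transpose A"
    by (simp add: gram_matrix_def A_def matrix_matrix_mult_def transpose_def inner_vec_def vec_eq_iff)
  have lin: "linear ((*v) A)" by simp
  have subW: "subspace W"
    unfolding W_def by (intro linear_subspace_image) auto
  have "inj_on ((*v) A) W"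
    unfolding linear_inj_on_iff_eq_0[OF lin subW]
  proof safe
    fix y assume "y \<in> W" "A *v y = 0"
    then obtain x where y: "y = transpose A *v x" by (auto simp: W_def)
    have "y \<bullet> y = x \<bullet> (A *v y)"
      by (metis dot_lmul_matrix vector_transpose_matrix transpose_matrix_vector y)
    then show "y = 0" using \<open>A *v y = 0\<close> by simp
  qed
  then have "dim ((*v) A ` W) = dim W"
    using subW by (intro dim_image_eq[OF lin]) (simp add: span_eq_iff[THEN iffD2])
  moreover have "(*v) A ` W = range (\<lambda>x. gram_matrix r *v x)"
    by (simp add: W_def G image_image matrix_vector_mul_assoc del: transpose_matrix_vector)
  ultimately have "rank (gram_matrix r) = rank (transpose A)"
    by (simp only: rank_dim_range W_def)
  also have "\<dots> = rank A" by (rule rank_transpose)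
  also have "\<dots> = dim (range r)"
    by (simp add: row_rank_def rows_def row_def A_def vec_nth_inverse full_SetCompr_eq)
  finally show ?thesis .
qed

text \<open>If the vectors span the whole space, a common normal is orthogonal to itself and so
  zero; otherwise their span lies in a hyperplane, whose normal serves as \<open>m\<close>.\<close>

lemma rank_gram_matrix_eq_3_iff:
  fixes r :: "'n::finite \<Rightarrow> real ^ 3"
  shows "rank (gram_matrix r) = 3 \<longleftrightarrow> \<not> (\<exists>m. m \<noteq> 0 \<and> (\<forall>k. m \<bullet> r k = 0))"
proof
  assume "rank (gram_matrix r) = 3"
  then have full: "span (range r) = UNIV"
    by (simp add: rank_gram_matrix flip: dim_eq_full)
  show "\<not> (\<exists>m. m \<noteq> 0 \<and> (\<forall>k. m \<bullet> r k = 0))"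
  proof safe
    fix m assume "m \<noteq> 0" "\<forall>k. m \<bullet> r k = 0"
    then have "range r \<subseteq> {x. m \<bullet> x = 0}" by auto
    then have "span (range r) \<subseteq> {x. m \<bullet> x = 0}"
      by (rule span_minimal) (rule subspace_hyperplane)
    then have "m \<in> {x. m \<bullet> x = 0}" unfolding full by blast
    then have "m \<bullet> m = 0" by simp
    with \<open>m \<noteq> 0\<close> show False by simp
  qed
next
  assume none: "\<not> (\<exists>m. m \<noteq> 0 \<and> (\<forall>k. m \<bullet> r k = 0))"
  show "rank (gram_matrix r) = 3"
  proof (rule ccontr)
    assume "rank (gram_matrix r) \<noteq> 3"
    moreover have "dim (range r) \<le> 3" using dim_subset_UNIV[of "range r"] by simp
    ultimately have "dim (range r) < DIM(real ^ 3)" by (simp add: rank_gram_matrix)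
    then obtain m where "m \<noteq> 0" "span (range r) \<subseteq> {x. m \<bullet> x = 0}"
      using lowdim_subset_hyperplane by blast
    then have "\<forall>k. m \<bullet> r k = 0" using span_base[of _ "range r"] by blast
    with none \<open>m \<noteq> 0\<close> show False by blast
  qed
qed

definition im_pauli :: "complex ^ 2 \<Rightarrow> complex ^ 2 \<Rightarrow> real ^ 3" where
  "im_pauli v w = vector [Im (cinner v (pauli_x *v w)), Im (cinner v (pauli_y *v w)),
     Im (cinner v (pauli_z *v w))]"

text \<open>In the Pauli expansion of \<open>\<rho>\<close> the coefficients are real, so taking
  imaginary parts commutes with it; the identity matrix contributes the term in
  \<open>cinner v w\<close>, which vanishes for orthogonal vectors.\<close>

lemma Im_cinner_bloch:
  assumes "is_bloch_vector \<rho> r"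
  shows "Im (cinner v (\<rho> *v w)) = (Im (cinner v w) + im_pauli v w \<bullet> r) / 2"
  using assms
  by (simp add: is_bloch_vector_iff cinner_def matrix_vector_mult_def sum_2 sum_3 inner_vec_def
      im_pauli_def pauli_x_def pauli_y_def pauli_z_def field_simps)

lemma cinner_2: "cinner v w = cnj (v $ 1) * w $ 1 + cnj (v $ 2) * w $ 2" for v w :: "complex ^ 2"
  by (simp add: cinner_def sum_2)

lemma cinner_pauli:
  fixes v w :: "complex ^ 2"
  shows "cinner v (pauli_x *v w) = cnj (v $ 1) * w $ 2 + cnj (v $ 2) * w $ 1"
    "cinner v (pauli_y *v w) = \<i> * (cnj (v $ 2) * w $ 1 - cnj (v $ 1) * w $ 2)"
    "cinner v (pauli_z *v w) = cnj (v $ 1) * w $ 1 - cnj (v $ 2) * w $ 2"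
  by (simp_all add: cinner_def matrix_vector_mult_def sum_2
      pauli_x_def pauli_y_def pauli_z_def algebra_simps)

text \<open>These are complex squares, not squared moduli. Put
  \<open>s = cnj (v $ 1) * w $ 2\<close>, \<open>t = cnj (v $ 2) * w $ 1\<close>, and let
  \<open>e\<close>, \<open>f\<close> be the two summands of \<open>cinner v w\<close>. The first two
  squares add up to \<open>4 * s * t = 4 * e * f\<close>, which turns \<open>(e - f)\<^sup>2\<close>
  into \<open>(e + f)\<^sup>2\<close>.\<close>

lemma cinner_pauli_squares:
  fixes v w :: "complex ^ 2"
  shows "(cinner v (pauli_x *v w))\<^sup>2 + (cinner v (pauli_y *v w))\<^sup>2 + (cinner v (pauli_z *v w))\<^sup>2
    = (cinner v w)\<^sup>2"
  unfolding cinner_pauli cinner_2[of v w] by (simp add: power2_eq_square algebra_simps)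

lemma im_pauli_nonzero:
  assumes orth: "cinner v w = 0" and "v \<noteq> 0" "w \<noteq> 0"
  shows "im_pauli v w \<noteq> 0"
proof
  assume zero: "im_pauli v w = 0"
  define x y z where "x = Re (cinner v (pauli_x *v w))" and "y = Re (cinner v (pauli_y *v w))"
    and "z = Re (cinner v (pauli_z *v w))"
  have re: "cinner v (pauli_x *v w) = of_real x" "cinner v (pauli_y *v w) = of_real y"
    "cinner v (pauli_z *v w) = of_real z"
    using zero by (auto simp: im_pauli_def vec_eq_iff forall_3 complex_eq_iff x_def y_def z_def)
  have "complex_of_real (x\<^sup>2 + y\<^sup>2 + z\<^sup>2) = 0"
    using cinner_pauli_squares[of v w] by (simp add: re orth)
  then have "x\<^sup>2 + y\<^sup>2 + z\<^sup>2 = 0" by (simp only: of_real_eq_0_iff)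
  then have "x = 0" "y = 0" "z = 0"
    by (smt (verit) zero_le_power2 power2_eq_square mult_eq_0_iff)+
  \<comment> \<open>The three Pauli forms and \<open>cinner v w\<close> are sums and differences
    that determine all four products; since all four forms vanish, so do the products.\<close>
  then have "cnj (v $ i) * w $ j = 0" for i j
    using re orth exhaust_2[of i] exhaust_2[of j] unfolding cinner_pauli cinner_2[of v w]
    by (auto simp: add_eq_0_iff)
  then show False
    using \<open>v \<noteq> 0\<close> \<open>w \<noteq> 0\<close> by (auto simp: vec_eq_iff)
qed

lemma exists_spinor_im_pauli:
  fixes m :: "real ^ 3"
  assumes "norm m = 1" "m $ 2 \<ge> 0"
  obtains p q :: complex where "cnj p * p + cnj q * q = 1"
    "im_pauli (vector [p, q]) (vector [- cnj q, cnj p]) = m"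
  \<comment> \<open>Writing \<open>p\<close>, \<open>q\<close> in real coordinates, \<open>m\<close> is a quadratic map of them (the Hopf map);
     making \<open>p\<close> real fixes the remaining freedom, and \<open>m $ 2 \<ge> 0\<close> keeps \<open>d = Im q\<close> nonzero.\<close>
proof -
  have unit: "(m $ 1)\<^sup>2 + (m $ 2)\<^sup>2 + (m $ 3)\<^sup>2 = 1"
    using assms(1) power2_norm_eq_inner[of m] by (simp add: inner_vec_def sum_3 power2_eq_square)
  \<comment> \<open>For \<open>p = a\<close> and \<open>q = c + \<i> * d\<close> the vector
    \<open>im_pauli\<close> is \<open>(2cd, d\<^sup>2 - a\<^sup>2 - c\<^sup>2, 2ad)\<close>. Adding
    the normalisation \<open>a\<^sup>2 + c\<^sup>2 + d\<^sup>2 = 1\<close> to its second entry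
    yields \<open>d\<close>; the other entries then yield \<open>c\<close> and
    \<open>a\<close>.\<close>
  define d where "d = sqrt ((1 + m $ 2) / 2)"
  have d: "d > 0" "d\<^sup>2 = (1 + m $ 2) / 2" using assms(2) by (auto simp: d_def)
  define a c where "a = m $ 3 / (2 * d)" and "c = m $ 1 / (2 * d)"
  have ad: "2 * (a * d) = m $ 3" "2 * (c * d) = m $ 1" using d(1) by (auto simp: a_def c_def)
  have "4 * (a\<^sup>2 + c\<^sup>2) * d\<^sup>2 = (m $ 3)\<^sup>2 + (m $ 1)\<^sup>2"
    unfolding ad[symmetric] by (simp add: algebra_simps power2_eq_square)
  also have "\<dots> = 2 * (1 - m $ 2) * d\<^sup>2"
  proof -
    have "(m $ 3)\<^sup>2 + (m $ 1)\<^sup>2 = (1 - m $ 2) * (1 + m $ 2)"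
      using unit by (simp add: algebra_simps power2_eq_square)
    then show ?thesis unfolding d(2) by simp
  qed
  finally have ac: "a\<^sup>2 + c\<^sup>2 = (1 - m $ 2) / 2" using d(1) by simp
  show ?thesis
  proof
    show "cnj (Complex a 0) * Complex a 0 + cnj (Complex c d) * Complex c d = 1"
      using ac d(2) by (simp add: complex_eq_iff power2_eq_square algebra_simps field_simps)
    show "im_pauli (vector [Complex a 0, Complex c d]) (vector [- cnj (Complex c d), cnj (Complex a 0)]) = m"
      using ac d(2) ad
      by (simp add: im_pauli_def cinner_pauli vec_eq_iff forall_3 power2_eq_square algebra_simps field_simps)
  qed
qed

lemma orthonormal_basis_spinor:
  assumes "cnj p * p + cnj q * q = 1"
  shows "orthonormal_basis (\<lambda>i::2. if i = 1 then vector [p, q] else vector [- cnj q, cnj p])"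
    (is "orthonormal_basis ?a")
proof -
  have "w \<in> vec.span (range ?a)" for w
  proof -
    \<comment> \<open>The coefficients are the Hermitian products of the two basis vectors with
      \<open>w\<close>.\<close>
    have "w = (cnj p * w $ 1 + cnj q * w $ 2) *s ?a 1 + (p * w $ 2 - q * w $ 1) *s ?a 2"
    proof -
      have "w $ i = (cnj p * p) * w $ i + (cnj q * q) * w $ i" for i
        by (simp add: assms flip: distrib_right)
      then show ?thesis
        by (simp add: vec_eq_iff forall_2) (simp add: algebra_simps)
    qed
    also have "\<dots> \<in> vec.span (range ?a)"
      by (intro vec.span_add vec.span_scale vec.span_base rangeI)
    finally show ?thesis .
  qed
  then show ?thesis
    using assms by (auto simp: orthonormal_basis_def forall_2 cinner_def sum_2 algebra_simps)
qed

lemma cinner_hermitian: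
  assumes "adjoint_mat A = A"
  shows "cinner w (A *v v) = cnj (cinner v (A *v w))"
proof -
  have h: "cnj (A $ i $ j) = A $ j $ i" for i j
    using arg_cong[OF assms, of "\<lambda>A. A $ j $ i"] by (simp add: adjoint_mat_def)
  show ?thesis
    by (simp add: cinner_def matrix_vector_mult_def sum_distrib_left h mult_ac)
      (subst sum.swap, rule refl)
qed

text \<open>Hermiticity makes diagonal entries real and the two off-diagonal ones conjugate, so a
  basis works exactly when the \<open>(1, 2)\<close> entries are real, that is, when
  \<open>im_pauli (a 1) (a 2)\<close> is orthogonal to every Bloch vector.\<close>

lemma imaginarity_free_iff:
  fixes \<rho> :: "'n::finite \<Rightarrow> complex ^ 2 ^ 2"
  assumes dens: "\<And>k. \<rho> k \<in> density_matrices"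
  shows "\<rho> \<in> imaginarity_free \<longleftrightarrow> (\<exists>m. m \<noteq> 0 \<and> (\<forall>k. m \<bullet> bloch_vector (\<rho> k) = 0))"
proof -
  have bloch: "is_bloch_vector (\<rho> k) (bloch_vector (\<rho> k))" for k
    unfolding bloch_vector_def by (rule theI'[OF bloch_vector_exists_unique[OF dens]])
  show ?thesis
  proof
    assume "\<rho> \<in> imaginarity_free"
    then obtain a where a: "orthonormal_basis a" and real: "\<And>k i j. cinner (a i) (\<rho> k *v a j) \<in> \<real>"
      by (auto simp: imaginarity_free_def)
    have ip: "cinner (a i) (a j) = (if i = j then 1 else 0)" for i j
      using a by (simp add: orthonormal_basis_def)
    have "a i \<noteq> 0" for i using ip[of i i] by (auto simp: cinner_def)
    then have "im_pauli (a 1) (a 2) \<noteq> 0" by (intro im_pauli_nonzero) (simp_all add: ip)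
    moreover have "im_pauli (a 1) (a 2) \<bullet> bloch_vector (\<rho> k) = 0" for k
      using Im_cinner_bloch[OF bloch[of k], of "a 1" "a 2"] real[of 1 k 2]
      by (simp add: ip complex_is_Real_iff)
    ultimately show "\<exists>m. m \<noteq> 0 \<and> (\<forall>k. m \<bullet> bloch_vector (\<rho> k) = 0)" by blast
  next
    assume "\<exists>m. m \<noteq> 0 \<and> (\<forall>k. m \<bullet> bloch_vector (\<rho> k) = 0)"
    then obtain m where m: "m \<noteq> 0" "\<And>k. m \<bullet> bloch_vector (\<rho> k) = 0" by blast
    \<comment> \<open>Both \<open>m\<close> and \<open>- m\<close> are normal to the same plane; the
      sign is chosen to make the second coordinate nonnegative, as
      \<open>exists_spinor_im_pauli\<close> requires.\<close>
    define u where "u = (if m $ 2 \<ge> 0 then 1 else - 1) *\<^sub>R sgn m"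
    have "norm u = 1" "u $ 2 \<ge> 0"
      using m(1) by (auto simp: u_def norm_sgn sgn_div_norm mult_nonpos_nonneg zero_le_mult_iff)
    then obtain p q where pq: "cnj p * p + cnj q * q = 1"
      "im_pauli (vector [p, q]) (vector [- cnj q, cnj p]) = u"
      by (rule exists_spinor_im_pauli)
    define a :: "2 \<Rightarrow> complex ^ 2"
      where "a = (\<lambda>i. if i = 1 then vector [p, q] else vector [- cnj q, cnj p])"
    have onb: "orthonormal_basis a"
      unfolding a_def by (rule orthonormal_basis_spinor[OF pq(1)])
    have herm: "cinner w (\<rho> k *v v) = cnj (cinner v (\<rho> k *v w))" for k v w
      using dens[of k] by (intro cinner_hermitian)
        (auto simp: density_matrices_def positive_semidefinite_def)
    have diag: "cinner (a i) (\<rho> k *v a i) \<in> \<real>" for i k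
      using herm[of "a i" k "a i"] by (simp add: Reals_cnj_iff)
    have off: "cinner (a 1) (\<rho> k *v a 2) \<in> \<real>" for k
    proof -
      have "u \<bullet> bloch_vector (\<rho> k) = 0" using m(2) by (simp add: u_def sgn_div_norm)
      moreover have "im_pauli (a 1) (a 2) = u" by (simp add: a_def pq(2))
      moreover have "cinner (a 1) (a 2) = 0" using onb by (simp add: orthonormal_basis_def)
      ultimately show ?thesis
        using Im_cinner_bloch[OF bloch[of k], of "a 1" "a 2"] by (simp add: complex_is_Real_iff)
    qed
    have "cinner (a 2) (\<rho> k *v a 1) \<in> \<real>" for k
      using off[of k] herm[of "a 2" k "a 1"] by (simp add: complex_is_Real_iff)
    with diag off have "cinner (a i) (\<rho> k *v a j) \<in> \<real>" for i j k
      using exhaust_2[of i] exhaust_2[of j] by auto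
    with onb dens show "\<rho> \<in> imaginarity_free" by (auto simp: imaginarity_free_def)
  qed
qed

theorem mainTheorem1:
  fixes \<rho> :: "'n::finite \<Rightarrow> complex ^ 2 ^ 2"
  assumes "\<And>k. \<rho> k \<in> density_matrices"
  shows "\<rho> \<notin> imaginarity_free \<longleftrightarrow> rank (gram_matrix (\<lambda>k. bloch_vector (\<rho> k))) = 3"
  by (simp only: imaginarity_free_iff[OF assms] rank_gram_matrix_eq_3_iff)

end
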